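(* Let $A$ be a $C^*$-algebra and let $u, v \in A$ be partial isometries such that $\|u - v\| < 1$. Then $u$ and $v$ are homotopic through partial isometries in $A$; that is, there is a norm-continuous map $w : [0,1] \to A$ such that $w(t)$ is a partial isometry for every $t \in [0,1]$, $w(0) = u$ and $w(1) = v$.
   Context: A partial isometry in a $C^*$-algebra is an element $u$ such that $u^*u$ is a projection (equivalently $uu^*u = u$). The $C^*$-algebra is not assumed to be unital. *)

theory Defs
  imports Complex_Main
begin

text \<open>
  Not necessarily unital C*-algebras. The distribution only has real normed algebras, so complex
  scalar multiplication is added as an operation; \<open>scaleR_scaleC\<close> says that it extends the
  real one and in particular yields \<open>scaleC 1 x = x\<close>. Completeness comes from \<open>banach\<close>
  and submultiplicativity of the norm from \<open>real_normed_algebra\<close>, which has no unit.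
\<close>

class cstar_algebra = real_normed_algebra + banach +
  fixes scaleC :: "complex \<Rightarrow> 'a \<Rightarrow> 'a"
    and adj :: "'a \<Rightarrow> 'a"
  assumes scaleC_add_right: "scaleC c (x + y) = scaleC c x + scaleC c y"
    and scaleC_add_left: "scaleC (c + d) x = scaleC c x + scaleC d x"
    and scaleC_scaleC: "scaleC c (scaleC d x) = scaleC (c * d) x"
    and scaleR_scaleC: "scaleR r x = scaleC (complex_of_real r) x"
    and mult_scaleC_left: "scaleC c x * y = scaleC c (x * y)"
    and mult_scaleC_right: "x * scaleC c y = scaleC c (x * y)"
    and norm_scaleC: "norm (scaleC c x) = cmod c * norm x"
    and adj_adj: "adj (adj x) = x"
    and adj_add: "adj (x + y) = adj x + adj y"
    and adj_scaleC: "adj (scaleC c x) = scaleC (cnj c) (adj x)"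
    and adj_mult: "adj (x * y) = adj y * adj x"
    and norm_adj_mult_self: "norm (adj x * x) = (norm x)\<^sup>2"

definition projection :: "'a::cstar_algebra \<Rightarrow> bool"
  where "projection p \<longleftrightarrow> p * p = p \<and> adj p = p"

definition partial_isometry :: "'a::cstar_algebra \<Rightarrow> bool"
  where "partial_isometry u \<longleftrightarrow> projection (adj u * u)"

end

theory Submission
  imports Defs "HOL-Analysis.Analysis"
begin

text \<open>
  Let \<open>p = u* u\<close>. Every \<open>a = a p\<close> with \<open>a* a\<close> invertible in the corner \<open>p A p\<close> has a polar part
  \<open>a (a* a) powr (-1/2)\<close>, a partial isometry depending continuously on \<open>a\<close>. When a multiple of
  \<open>a* a\<close> has distance less than 1 from \<open>p\<close>, the inverse square root is given by the binomial series.
  Since \<open>norm (u - v) < 1\<close>, the segment from \<open>p\<close> to \<open>u* v p\<close> is invertible in the corner, which leads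
  from \<open>u\<close> to \<open>(u u*) v p\<close>; from there a segment leads to \<open>v p\<close>. Symmetrically, \<open>v*\<close> is joined to
  \<open>p v*\<close> relative to \<open>v v*\<close>, and the polar parts of \<open>v p\<close> and \<open>p v*\<close> are adjoint to each other.

  The delicate point is to see that \<open>y* y\<close> is positive for invertible \<open>y\<close> on the first segment.
  Rather than proving positivity of \<open>y* y\<close> in general, it is carried along the segment by continuity.
\<close>

section \<open>The involution\<close>

text \<open>The C*-identity and submultiplicativity give one inequality; applying it to
  \<open>adj x\<close> as well gives the other.\<close>

lemma norm_adj [simp]: "norm (adj x) = norm (x::'a::cstar_algebra)"
proof -
  have le: "norm y \<le> norm (adj y)" for y :: 'a
  proof (cases "y = 0")
    case False
    have "norm y * norm y \<le> norm (adj y) * norm y"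
      using norm_adj_mult_self[of y] norm_mult_ineq[of "adj y" y] by (simp add: power2_eq_square)
    with False show ?thesis by simp
  qed simp
  show ?thesis using le[of x] le[of "adj x"] by (simp add: adj_adj)
qed

lemma adj_scaleR: "adj (r *\<^sub>R x) = r *\<^sub>R adj (x::'a::cstar_algebra)"
  by (simp add: scaleR_scaleC adj_scaleC)

lemma bounded_linear_adj: "bounded_linear (adj :: 'a::cstar_algebra \<Rightarrow> 'a)"
  by (rule bounded_linear_intro[where K = 1]) (simp_all add: adj_add adj_scaleR)

lemmas adj_diff = bounded_linear.linear[OF bounded_linear_adj, THEN linear_diff]
lemmas continuous_on_adj [continuous_intros] = bounded_linear.continuous_on[OF bounded_linear_adj]

lemma norm_self_adjoint_square:
  fixes x :: "'a::cstar_algebra"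
  assumes "adj x = x" shows "norm (x * x) = (norm x)\<^sup>2"
  using norm_adj_mult_self[of x] assms by simp

section \<open>Projections and corners\<close>

text \<open>For a projection \<open>p\<close> this is \<open>p A p\<close>, a C*-algebra with unit
  \<open>p\<close>. Such units stand in for the unit that the algebra may lack.\<close>

definition corner :: "'a::cstar_algebra \<Rightarrow> 'a set"
  where "corner p = {x. p * x = x \<and> x * p = x}"

lemma cornerD: "x \<in> corner p \<Longrightarrow> p * x = x" "x \<in> corner p \<Longrightarrow> x * p = x"
  by (auto simp: corner_def)

lemma corner_diff: "x \<in> corner p \<Longrightarrow> y \<in> corner p \<Longrightarrow> x - y \<in> corner p"
  by (auto simp: corner_def algebra_simps)

lemma corner_scaleR: "x \<in> corner p \<Longrightarrow> r *\<^sub>R x \<in> corner p"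
  by (auto simp: corner_def)

lemma corner_mult: "x \<in> corner p \<Longrightarrow> y \<in> corner p \<Longrightarrow> x * y \<in> corner p"
  by (auto simp: corner_def mult.assoc) (auto simp flip: mult.assoc)

lemma corner_self: "projection p \<Longrightarrow> p \<in> corner p"
  by (simp add: corner_def projection_def)

lemma corner_adj: "projection p \<Longrightarrow> x \<in> corner p \<Longrightarrow> adj x \<in> corner p"
  by (auto simp: corner_def projection_def) (metis adj_mult)+

lemma norm_projection_le: 
  assumes "projection p" shows "norm p \<le> 1"
proof -
  have "(norm p)\<^sup>2 = norm p"
    using norm_self_adjoint_square[of p] assms by (simp add: projection_def)
  then show ?thesis by (auto simp: power2_eq_square)
qed

text \<open>Right multiplication by \<open>1 - 2p\<close> is isometric, and \<open>1 - p\<close> is the mean of it and 1.\<close>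

lemma norm_diff_mult_projection_le:
  fixes x :: "'a::cstar_algebra"
  assumes "projection p" shows "norm (x - x * p) \<le> norm x"
proof -
  let ?y = "x - 2 *\<^sub>R (x * p)"
  have p: "p * p = p" "adj p = p" using assms by (auto simp: projection_def)
  have pp: "p * (p * z) = p * z" for z using p(1) by (simp flip: mult.assoc)
  \<comment> \<open>Passing to adjoints brings the two factors \<open>1 - 2p\<close> next to each
    other, and their product is 1.\<close>
  have "adj (adj ?y) * adj ?y = adj (adj x) * adj x"
    by (simp add: adj_diff adj_scaleR adj_mult p adj_adj algebra_simps pp flip: scaleR_scaleR)
      (simp add: scaleR_2)
  then have "(norm ?y)\<^sup>2 = (norm x)\<^sup>2"
    using norm_adj_mult_self[of "adj ?y"] norm_adj_mult_self[of "adj x"] by simp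
  then have "norm ?y = norm x" by simp
  moreover have "x - x * p = (1/2) *\<^sub>R (x + ?y)"
    by (simp add: algebra_simps scaleR_add_left[symmetric] flip: scaleR_2)
  ultimately show ?thesis
    using norm_triangle_ineq[of x ?y] by simp
qed

section \<open>The inverse square root in a corner\<close>

text \<open>The zeroth power is \<open>p\<close>, the unit of the corner in which \<open>z\<close>
  is meant to lie.\<close>

primrec cpow :: "'a::cstar_algebra \<Rightarrow> 'a \<Rightarrow> nat \<Rightarrow> 'a" where
  "cpow p z 0 = p"
| "cpow p z (Suc n) = z * cpow p z n"

text \<open>This is \<open>(2n choose n) / 4^n\<close>, the Taylor coefficient of
  \<open>(1 - x) powr (-1/2)\<close>.\<close>

definition isqrt_coeff :: "nat \<Rightarrow> real"
  where "isqrt_coeff n = pochhammer (1/2) n / fact n"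

text \<open>The binomial series of \<open>(p - z) powr (-1/2)\<close>, with \<open>p\<close> as the unit.\<close>

definition isqrt :: "'a::cstar_algebra \<Rightarrow> 'a \<Rightarrow> 'a"
  where "isqrt p z = (\<Sum>n. isqrt_coeff n *\<^sub>R cpow p z n)"

lemma norm_cpow_le: "norm (cpow p z n) \<le> norm z ^ n * norm p"
proof (induction n)
  case (Suc n)
  have "norm (z * cpow p z n) \<le> norm z * norm (cpow p z n)" by (rule norm_mult_ineq)
  also have "\<dots> \<le> norm z * (norm z ^ n * norm p)" by (intro mult_left_mono Suc) simp
  finally show ?case by (simp add: mult.assoc)
qed simp

lemma cpow_mult:
  assumes "projection p" "z \<in> corner p"
  shows "cpow p z m * cpow p z n = cpow p z (m + n)"
proof (induction m)
  case 0
  then show ?case using assms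
    by (cases n) (auto simp: projection_def corner_def simp flip: mult.assoc)
qed (simp add: mult.assoc)

lemma isqrt_coeff_bounds: "0 \<le> isqrt_coeff n" "isqrt_coeff n \<le> 1"
proof -
  have "pochhammer (1/2) n \<le> (pochhammer 1 n :: real)"
    unfolding pochhammer_prod by (intro prod_mono) auto
  then show "isqrt_coeff n \<le> 1" by (simp add: isqrt_coeff_def pochhammer_fact[symmetric])
  show "0 \<le> isqrt_coeff n"
    by (auto simp: isqrt_coeff_def pochhammer_prod intro!: divide_nonneg_nonneg prod_nonneg)
qed

text \<open>The square of \<open>(1 - x) powr (-1/2)\<close> is the geometric series. On
  coefficients this is the Vandermonde identity for rising factorials, with 1/2 + 1/2 = 1.\<close>

lemma isqrt_coeff_convolution: "(\<Sum>k\<le>n. isqrt_coeff k * isqrt_coeff (n - k)) = 1"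
proof -
  have "(fact n::real) = (\<Sum>k\<le>n. of_nat (n choose k) * pochhammer (1/2) k * pochhammer (1/2) (n - k))"
    using pochhammer_binomial_sum[of "1/2::real" "1/2" n] by (simp add: pochhammer_fact[symmetric])
  also have "\<dots> = (\<Sum>k\<le>n. fact n * (isqrt_coeff k * isqrt_coeff (n - k)))"
    by (intro sum.cong) (auto simp: isqrt_coeff_def binomial_fact)
  finally have "fact n * 1 = (fact n::real) * (\<Sum>k\<le>n. isqrt_coeff k * isqrt_coeff (n - k))"
    by (simp add: sum_distrib_left)
  then show ?thesis by (simp del: mult_1_right)
qed

lemma norm_isqrt_term_le: "norm (isqrt_coeff n *\<^sub>R cpow p z n) \<le> norm z ^ n * norm p"
proof -
  have "norm (isqrt_coeff n *\<^sub>R cpow p z n) \<le> 1 * norm (cpow p z n)"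
    unfolding norm_scaleR using isqrt_coeff_bounds[of n] by (intro mult_right_mono) auto
  then show ?thesis using norm_cpow_le[of p z n] by simp
qed

lemma summable_norm_isqrt:
  assumes "norm z < 1"
  shows "summable (\<lambda>n. norm (isqrt_coeff n *\<^sub>R cpow p z n))"
  by (rule summable_comparison_test'[where g = "\<lambda>n. norm z ^ n * norm p" and N = 0])
    (use assms norm_isqrt_term_le[of _ p z] in \<open>auto intro!: summable_mult2 summable_geometric\<close>)

lemmas summable_isqrt = summable_norm_isqrt[THEN summable_norm_cancel]

text \<open>The relation passes to all powers and hence to the series. With \<open>p = p'\<close>
  and \<open>z = z'\<close> this gives commutation; two different corners occur only when polar
  parts are compared at the end.\<close>

lemma isqrt_intertwine:
  assumes "norm z < 1" "norm z' < 1" "x * p = p' * x" "x * z = z' * x"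
  shows "x * isqrt p z = isqrt p' z' * x"
proof -
  have "x * cpow p z n = cpow p' z' n * x" for n
  proof (induction n)
    case (Suc n)
    then show ?case using assms(4) by (metis cpow.simps(2) mult.assoc)
  qed (simp add: assms)
  then show ?thesis
    unfolding isqrt_def
    by (simp add: suminf_mult2[OF summable_isqrt[OF assms(2)]]
        suminf_mult[OF summable_isqrt[OF assms(1)], symmetric])
qed

lemma isqrt_adj:
  assumes "projection p" "z \<in> corner p" "adj z = z" "norm z < 1"
  shows "adj (isqrt p z) = isqrt p z"
proof -
  have p: "p * p = p" "adj p = p" using assms by (auto simp: projection_def)
  have comm: "cpow p z n * z = z * cpow p z n" for n
    using assms by (induction n) (auto simp: corner_def mult.assoc)
  have "adj (cpow p z n) = cpow p z n" for n
    by (induction n) (use assms in \<open>auto simp: adj_mult p comm\<close>)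
  then show ?thesis
    unfolding isqrt_def
    by (simp add: bounded_linear.suminf[OF bounded_linear_adj summable_isqrt[OF assms(4)]] adj_scaleR)
qed

lemma isqrt_corner:
  assumes "projection p" "z \<in> corner p" "norm z < 1"
  shows "isqrt p z \<in> corner p"
proof -
  have p: "p * p = p" using assms by (auto simp: projection_def)
  have "p * cpow p z n = cpow p z n" for n
    using assms(2) by (cases n) (auto simp: p corner_def simp flip: mult.assoc)
  then have "p * isqrt p z = isqrt p z"
    unfolding isqrt_def by (simp add: suminf_mult[OF summable_isqrt[OF assms(3)], symmetric])
  moreover have "p * isqrt p z = isqrt p z * p"
    using assms by (intro isqrt_intertwine) (auto simp: corner_def)
  ultimately show ?thesis by (simp add: corner_def)
qed

lemma isqrt_zero [simp]: "isqrt p 0 = p"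
proof -
  have "isqrt_coeff n *\<^sub>R cpow p 0 n = (if n = 0 then p else 0)" for n
    by (cases n) (auto simp: isqrt_coeff_def)
  then show ?thesis unfolding isqrt_def by (subst suminf_finite[of "{0}"]) (auto simp: isqrt_coeff_def)
qed

text \<open>By the convolution identity the square of the series is the geometric series of
  \<open>z\<close>, which telescopes against \<open>p - z\<close>.\<close>

lemma isqrt_square:
  assumes "projection p" "z \<in> corner p" "norm z < 1"
  shows "isqrt p z * isqrt p z * (p - z) = p"
proof -
  let ?c = "\<lambda>n. isqrt_coeff n *\<^sub>R cpow p z n"
  have pz: "cpow p z n * p = cpow p z n" for n
    using cpow_mult[OF assms(1,2), of n 0] by simp
  have zz: "cpow p z n * z = cpow p z (Suc n)" for n
    using cpow_mult[OF assms(1,2), of n 1] assms(2) by (simp add: corner_def)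
  have "(\<Sum>k\<le>n. ?c k * ?c (n - k)) = cpow p z n" for n
  proof -
    have "(\<Sum>k\<le>n. ?c k * ?c (n - k)) = (\<Sum>k\<le>n. (isqrt_coeff k * isqrt_coeff (n - k)) *\<^sub>R cpow p z n)"
      by (intro sum.cong) (auto simp: cpow_mult[OF assms(1,2)])
    then show ?thesis by (simp add: isqrt_coeff_convolution flip: scaleR_left.sum)
  qed
  then have "(cpow p z) sums (isqrt p z * isqrt p z)"
    using Cauchy_product_sums[OF summable_norm_isqrt[OF assms(3), of p] summable_norm_isqrt[OF assms(3), of p]]
    unfolding isqrt_def by simp
  then have "(\<lambda>n. cpow p z n * (p - z)) sums (isqrt p z * isqrt p z * (p - z))"
    by (rule sums_mult2)
  moreover have "(\<lambda>n. cpow p z n * (p - z)) sums (cpow p z 0 - 0)"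
  proof -
    have "cpow p z \<longlonglongrightarrow> 0"
      using \<open>(cpow p z) sums _\<close> summable_LIMSEQ_zero sums_summable by blast
    then show ?thesis
      using telescope_sums'[of "cpow p z" 0] by (simp add: right_diff_distrib pz zz)
  qed
  ultimately show ?thesis using sums_unique2 by fastforce
qed

text \<open>Weierstrass M-test: on a ball of radius \<open>r < 1\<close> the terms are dominated by
  \<open>r ^ n * norm p\<close>.\<close>

lemma continuous_on_isqrt:
  fixes p :: "'a::cstar_algebra"
  shows "continuous_on (ball 0 1) (isqrt p)"
proof -
  have cpow: "continuous_on S (\<lambda>z. cpow p z n)" for n and S :: "'a set"
    by (induction n) (auto intro!: continuous_intros)
  have "isCont (isqrt p) z" if "norm z < 1" for z
  proof -
    define r where "r = (1 + norm z) / 2"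
    have r: "norm z < r" "r < 1" "0 \<le> r" using that norm_ge_zero[of z] by (auto simp: r_def)
    have "uniform_limit (cball 0 r) (\<lambda>n x. \<Sum>i<n. isqrt_coeff i *\<^sub>R cpow p x i) (isqrt p) sequentially"
      unfolding isqrt_def
    proof (rule Weierstrass_m_test)
      show "norm (isqrt_coeff n *\<^sub>R cpow p x n) \<le> r ^ n * norm p" if "x \<in> cball 0 r" for n x
        by (rule order_trans[OF norm_isqrt_term_le]) (use that in \<open>auto intro!: mult_right_mono power_mono\<close>)
      show "summable (\<lambda>n. r ^ n * norm p)" using r by (intro summable_mult2 summable_geometric) auto
    qed
    moreover have "\<forall>\<^sub>F n in sequentially. continuous_on (cball 0 r) (\<lambda>x. \<Sum>i<n. isqrt_coeff i *\<^sub>R cpow p x i)"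
      by (intro always_eventually allI continuous_on_sum continuous_on_scaleR continuous_on_const cpow)
    ultimately have "continuous_on (cball 0 r) (isqrt p)"
      by (intro uniform_limit_theorem[where F = sequentially]) auto
    then show ?thesis
      using r interiorI[of "ball 0 r" z "cball 0 r"] by (intro continuous_on_interior[of "cball 0 r"]) auto
  qed
  then show ?thesis by (auto intro: continuous_at_imp_continuous_on)
qed

section \<open>Norm estimates for self-adjoint elements\<close>

text \<open>The norm bound on \<open>k\<close> holds because \<open>e + \<i> k\<close> is unitary in the corner.\<close>

lemma sqrt_complement:
  fixes e :: "'a::cstar_algebra"
  assumes p: "projection p" and e: "e \<in> corner p" "adj e = e" "norm e < 1"
  obtains k where "k \<in> corner p" "adj k = k" "k * k = p - e * e" "norm k \<le> 1"
    "\<And>x. x \<in> corner p \<Longrightarrow> x * (e * e) = e * e * x \<Longrightarrow> x * k = k * x"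
proof -
  let ?z = "e * e"
  let ?s = "isqrt p ?z"
  \<comment> \<open>Since \<open>?s\<close> is the inverse square root of \<open>p - ?z\<close>,
    this is the square root of \<open>p - ?z\<close>.\<close>
  define k where "k = ?s * (p - ?z)"
  have pp: "adj p = p" "p * p = p" using p by (auto simp: projection_def)
  have z: "?z \<in> corner p" "adj ?z = ?z" "norm ?z < 1"
    using e by (auto simp: adj_mult norm_self_adjoint_square power_less_one_iff intro: corner_mult)
  have pz: "p - ?z \<in> corner p" by (intro corner_diff corner_self p z)
  have s: "?s \<in> corner p" "adj ?s = ?s" "?s * ?s * (p - ?z) = p"
    using isqrt_corner isqrt_adj isqrt_square p z by blast+
  have scomm: "x * ?s = ?s * x" if "x \<in> corner p" "x * ?z = ?z * x" for x
    using that z by (intro isqrt_intertwine) (auto simp: corner_def)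
  have sz: "(p - ?z) * ?s = ?s * (p - ?z)"
    by (rule scomm[OF pz]) (use z in \<open>simp add: corner_def algebra_simps\<close>)
  have k: "k \<in> corner p" "adj k = k"
    unfolding k_def using s(2) by (auto simp: adj_mult adj_diff pp z e sz intro: corner_mult pz s)
  have "k * k = ?s * ((p - ?z) * ?s) * (p - ?z)" by (simp add: k_def mult.assoc)
  also have "\<dots> = (?s * ?s * (p - ?z)) * (p - ?z)" by (simp add: sz mult.assoc)
  also have "\<dots> = p - ?z" using s(3) cornerD[OF pz] by simp
  finally have kk: "k * k = p - ?z" .
  have comm: "x * k = k * x" if "x \<in> corner p" "x * ?z = ?z * x" for x
  proof -
    have "x * k = ?s * (x * (p - ?z))" by (simp add: k_def scomm[OF that] flip: mult.assoc)
    also have "x * (p - ?z) = (p - ?z) * x" using that by (simp add: algebra_simps corner_def)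
    finally show ?thesis by (simp add: k_def mult.assoc)
  qed
  have ek: "e * k = k * e" by (rule comm) (use e in \<open>auto simp: mult.assoc\<close>)
  define w where "w = e + scaleC \<i> k"
  have adjw: "adj w = e + scaleC (-\<i>) k" by (simp add: w_def adj_add adj_scaleC e k)
  have neg: "scaleC c k + scaleC (-c) k = 0" for c
    using scaleC_add_left[of c "-c" k] scaleR_scaleC[of 0 k] by simp
  have one: "scaleC 1 x = x" for x :: 'a using scaleR_scaleC[of 1 x] by simp
  have "adj w * w = e * e + k * k + (scaleC \<i> (k * e) + scaleC (-\<i>) (k * e))"
    unfolding adjw unfolding w_def
    by (simp add: distrib_left distrib_right mult_scaleC_left mult_scaleC_right scaleC_scaleC ek one scaleC_add_right)
  also have "scaleC \<i> (k * e) + scaleC (-\<i>) (k * e) = (scaleC \<i> k + scaleC (-\<i>) k) * e"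
    by (simp add: distrib_right mult_scaleC_left)
  finally have "adj w * w = p" by (simp add: neg kk)
  then have "(norm w)\<^sup>2 \<le> 1"
    using norm_adj_mult_self[of w] norm_projection_le[OF p] by simp
  then have w1: "norm w \<le> 1" by (simp add: power_le_one_iff abs_square_le_1)
  \<comment> \<open>\<open>k\<close> is the imaginary part of \<open>w\<close>, so its norm is at
    most that of \<open>w\<close>.\<close>
  have "w - adj w = scaleC \<i> k - scaleC (-\<i>) k" unfolding adjw by (simp add: w_def)
  also have "\<dots> = scaleC \<i> k + scaleC \<i> k" using neg[of \<i>] by (simp add: diff_eq_eq add.assoc)
  also have "\<dots> = scaleC (2 * \<i>) k" by (simp flip: scaleC_add_left)
  finally have "2 * norm k = norm (w - adj w)" by (simp add: norm_scaleC norm_mult)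
  also have "\<dots> \<le> 2" using norm_triangle_ineq4[of w "adj w"] w1 by simp
  finally have "norm k \<le> 1" by simp
  from that[OF k kk this comm] show ?thesis .
qed

text \<open>Dividing \<open>e\<close> by \<open>sqrt M\<close> makes \<open>sqrt_complement\<close>
  applicable, so the element is \<open>M\<close> times the square of a self-adjoint
  contraction.\<close>

lemma norm_scaled_projection_minus_square_le:
  fixes e :: "'a::cstar_algebra"
  assumes p: "projection p" and e: "e \<in> corner p" "adj e = e" "(norm e)\<^sup>2 < M"
  shows "norm (M *\<^sub>R p - e * e) \<le> M"
proof -
  have M: "M > 0" using e(3) by (meson le_less_trans zero_le_power2)
  define e' where "e' = (1 / sqrt M) *\<^sub>R e"
  have "norm e < sqrt M" using e(3) by (simp add: real_less_rsqrt)
  then have "norm e' < 1" using M by (simp add: e'_def)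
  then obtain k where k: "adj k = k" "k * k = p - e' * e'" "norm k \<le> 1"
    using sqrt_complement[OF p, of e'] e by (auto simp: e'_def adj_scaleR intro: corner_scaleR)
  have "M *\<^sub>R p - e * e = M *\<^sub>R (k * k)"
    using M by (simp add: k(2) e'_def scaleR_diff_right)
  moreover have "norm (k * k) \<le> 1"
    unfolding norm_self_adjoint_square[OF k(1)] using k(3) by (simp add: power_le_one)
  ultimately show ?thesis using M by (simp add: mult_left_le)
qed

text \<open>
  The hypothesis on \<open>T\<close> says that \<open>m\<close> is positive and invertible; the conclusion says the same with
  a constant that only depends on the norms of \<open>m\<close> and of its inverse. It holds because
  \<open>m - (1/M) p\<close> is the square of a self-adjoint element.
\<close>

lemma positive_invertible_norm_bound:
  fixes m n :: "'a::cstar_algebra"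
  assumes p: "projection p" and m: "m \<in> corner p" "adj m = m" "norm m < M"
    and n: "n \<in> corner p" "n * m = p" "norm n < M"
    and T: "norm (T *\<^sub>R p - m) < T"
  shows "norm ((M + 1 / M) *\<^sub>R p - m) \<le> M"
proof -
  have T0: "T > 0" using T norm_ge_zero le_less_trans by blast
  have M0: "M > 0" using m(3) norm_ge_zero le_less_trans by blast
  have pp: "adj p = p" "p * p = p" using p by (auto simp: projection_def)
  define z where "z = p - (1/T) *\<^sub>R m"
  have z: "z \<in> corner p" "adj z = z"
    using corner_self[OF p] m by (auto simp: z_def adj_diff adj_scaleR pp intro!: corner_diff corner_scaleR)
  have "z = (1/T) *\<^sub>R (T *\<^sub>R p - m)" using T0 by (simp add: z_def scaleR_diff_right)
  then have z1: "norm z < 1" using T T0 by simp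
  \<comment> \<open>As \<open>p - z = (1/T) m\<close>, this is \<open>sqrt T\<close> times the
    inverse square root of \<open>m\<close>.\<close>
  define s where "s = isqrt p z"
  have s: "s \<in> corner p" "adj s = s" "s * s * (p - z) = p"
    using isqrt_corner isqrt_adj isqrt_square p z z1 unfolding s_def by blast+
  have sm: "m * s = s * m"
    unfolding s_def using m(1) z1
    by (intro isqrt_intertwine) (auto simp: corner_def z_def algebra_simps)
  have ssm: "s * s * m = T *\<^sub>R p" using s(3) T0 by (auto simp: z_def)
  have mss: "m * (s * s) = T *\<^sub>R p" 
    using ssm sm by (metis mult.assoc)
  have "n * (m * (s * s)) = s * s" using n(2) s(1) by (simp add: corner_def flip: mult.assoc)
  then have nss: "s * s = T *\<^sub>R n" using mss n(1) by (simp add: corner_def)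
  \<comment> \<open>The square root of \<open>(1/M) n\<close>. Its norm is below 1 however large
    \<open>T\<close> is, and \<open>k\<close> below is the square root of
    \<open>p - (1/M) n\<close>.\<close>
  define e where "e = (1 / sqrt (T * M)) *\<^sub>R s"
  have ee: "e * e = (1 / M) *\<^sub>R n"
    using T0 M0 by (simp add: e_def nss real_sqrt_mult_self flip: real_sqrt_mult)
  have e: "e \<in> corner p" "adj e = e" using s by (auto simp: e_def adj_scaleR intro: corner_scaleR)
  have "(norm e)\<^sup>2 = norm n / M" using norm_self_adjoint_square[OF e(2)] M0 by (simp add: ee)
  then have "(norm e)\<^sup>2 < 1" using n(3) M0 by simp
  then have "norm e < 1" by (simp add: power_less_one_iff abs_square_less_1)
  then obtain k where k: "k \<in> corner p" "adj k = k" "k * k = p - e * e" "norm k \<le> 1"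
    "\<And>x. x \<in> corner p \<Longrightarrow> x * (e * e) = e * e * x \<Longrightarrow> x * k = k * x"
    using sqrt_complement[OF p e] by blast
  \<comment> \<open>The square root of \<open>m\<close>, so that \<open>g * k\<close> becomes a
    self-adjoint square root of \<open>m - (1/M) p\<close>.\<close>
  define g where "g = (1 / sqrt T) *\<^sub>R (m * s)"
  have g: "g \<in> corner p" "adj g = g"
    using m s by (auto simp: g_def adj_scaleR adj_mult sm intro: corner_scaleR corner_mult)
  have "(m * s) * (m * s) = m * (m * (s * s))" by (metis sm mult.assoc)
  also have "\<dots> = T *\<^sub>R m" using m(1) by (simp add: mss corner_def)
  finally have gg: "g * g = m" using T0 by (simp add: g_def)
  have "(m * s) * (s * s) = (s * s) * (m * s)" by (metis sm mult.assoc)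
  then have "g * (e * e) = e * e * g" by (simp add: g_def e_def)
  then have gk: "g * k = k * g" using k(5) g(1) by blast
  have "(g * k) * (g * k) = (g * g) * (k * k)" by (metis gk mult.assoc)
  also have "\<dots> = m - (1 / M) *\<^sub>R (m * n)"
    using m(1) by (simp add: gg k(3) ee right_diff_distrib corner_def)
  also have "m * n = p"
    using mss T0 by (simp add: nss)
  finally have sq: "(g * k) * (g * k) = m - (1 / M) *\<^sub>R p" .
  have "(norm (g * k))\<^sup>2 \<le> (norm g * 1)\<^sup>2"
    by (intro power_mono order_trans[OF norm_mult_ineq] mult_left_mono k) auto
  also have "\<dots> = norm m" using norm_self_adjoint_square[OF g(2)] by (simp add: gg)
  also have "\<dots> < M" by fact
  finally have "norm (M *\<^sub>R p - (g * k) * (g * k)) \<le> M"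
    using g k by (intro norm_scaled_projection_minus_square_le p corner_mult) (auto simp: adj_mult gk)
  then show ?thesis unfolding sq by (simp add: algebra_simps)
qed

section \<open>Partial isometries as polar parts\<close>

text \<open>By the C*-identity it suffices that the difference \<open>d\<close> of the two sides
  satisfies \<open>adj d * d = 0\<close>; after expansion every term is \<open>adj u * u\<close> up
  to sign.\<close>

lemma partial_isometry_mult:
  fixes u :: "'a::cstar_algebra"
  assumes "partial_isometry u"
  shows "u * (adj u * u) = u"
proof -
  let ?p = "adj u * u"
  have p: "?p * ?p = ?p" "adj ?p = ?p"
    using assms by (auto simp: partial_isometry_def projection_def)
  have "adj (u - u * ?p) * (u - u * ?p) = ?p - ?p * ?p - ?p * ?p + ?p * ?p * ?p"
    by (simp add: adj_diff adj_mult adj_adj algebra_simps)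
  then have "adj (u - u * ?p) * (u - u * ?p) = 0" by (simp only: p) simp
  then show ?thesis using norm_adj_mult_self[of "u - u * ?p"] by simp
qed

lemma partial_isometry_adj:
  fixes u :: "'a::cstar_algebra"
  assumes "partial_isometry u"
  shows "partial_isometry (adj u)"
  using partial_isometry_mult[OF assms]
  by (simp add: partial_isometry_def projection_def adj_adj adj_mult) (metis mult.assoc)

lemma norm_partial_isometry_le:
  assumes "partial_isometry u" shows "norm u \<le> 1"
proof -
  have "(norm u)\<^sup>2 \<le> 1"
    using norm_projection_le[of "adj u * u"] assms
    by (simp add: partial_isometry_def norm_adj_mult_self)
  then show ?thesis by (simp add: abs_square_le_1)
qed

section \<open>Polar parts and paths in their domain\<close>

definition polar_domain :: "'a::cstar_algebra \<Rightarrow> 'a set"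
  where "polar_domain p = {a. a * p = a \<and> norm (p - adj a * a) < 1}"

text \<open>The second factor is the inverse square root of \<open>adj a * a\<close> in the corner;
  the norm bound in \<open>polar_domain\<close> makes its series converge.\<close>

definition polar_part :: "'a::cstar_algebra \<Rightarrow> 'a \<Rightarrow> 'a"
  where "polar_part p a = a * isqrt p (p - adj a * a)"

lemma adj_mult_self_corner:
  assumes "projection p" "a * p = a"
  shows "adj a * a \<in> corner p"
proof -
  have "p * adj a = adj a" using assms by (metis adj_mult projection_def)
  then show ?thesis using assms(2) by (simp add: corner_def mult.assoc) (simp flip: mult.assoc)
qed

text \<open>The inverse square root \<open>s\<close> commutes with \<open>adj a * a\<close>, so
  \<open>s * (adj a * a) * s = p\<close>: the polar part has initial projection
  \<open>p\<close>.\<close>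

lemma partial_isometry_polar_part:
  assumes p: "projection p" and a: "a \<in> polar_domain p"
  shows "partial_isometry (polar_part p a)"
proof -
  define z where "z = p - adj a * a"
  have c: "adj a * a \<in> corner p" using p a by (intro adj_mult_self_corner) (auto simp: polar_domain_def)
  have z: "z \<in> corner p" "adj z = z" "norm z < 1"
    using p c a
    by (auto simp: z_def polar_domain_def adj_diff adj_mult adj_adj projection_def
        intro!: corner_diff corner_self)
  define s where "s = isqrt p z"
  have s: "s \<in> corner p" "adj s = s" "s * s * (p - z) = p"
    using isqrt_corner isqrt_adj isqrt_square p z unfolding s_def by blast+
  have "z * s = s * z" unfolding s_def using z by (intro isqrt_intertwine) (auto simp: corner_def)
  then have comm: "(p - z) * s = s * (p - z)" using s by (simp add: algebra_simps corner_def)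
  have "adj (polar_part p a) * polar_part p a = s * ((p - z) * s)"
    unfolding polar_part_def z_def[symmetric] s_def[symmetric]
    by (simp add: adj_mult s z_def mult.assoc)
  also have "\<dots> = p" using s(3) by (simp add: comm mult.assoc)
  finally show ?thesis using p by (simp add: partial_isometry_def)
qed

lemma path_component_continuous_image:
  assumes "continuous_on S f" "f ` S \<subseteq> T" "path_component S a b"
  shows "path_component T (f a) (f b)"
proof -
  obtain g where g: "path g" "path_image g \<subseteq> S" "pathstart g = a" "pathfinish g = b"
    using assms(3) by (auto simp: path_component_def)
  then have "path (f \<circ> g)" "path_image (f \<circ> g) \<subseteq> T"
    using assms(1,2) continuous_on_subset
    by (auto simp: path_image_compose intro!: path_continuous_image)
  then show ?thesis
    using g by (auto simp: path_component_def pathstart_compose pathfinish_compose)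
qed

lemma path_component_polar_part:
  assumes p: "projection p" and ab: "path_component (polar_domain p) a b"
  shows "path_component (Collect partial_isometry) (polar_part p a) (polar_part p b)"
proof -
  have "continuous_on (polar_domain p) (polar_part p)"
    unfolding polar_part_def
    by (intro continuous_intros continuous_on_compose2[OF continuous_on_isqrt])
      (auto simp: polar_domain_def)
  moreover have "polar_part p ` polar_domain p \<subseteq> Collect partial_isometry"
    using partial_isometry_polar_part[OF p] by auto
  ultimately show ?thesis
    using path_component_continuous_image ab by blast
qed

lemma polar_domain_partial_isometry:
  assumes "partial_isometry u"
  shows "u \<in> polar_domain (adj u * u)" "polar_part (adj u * u) u = u"
  using partial_isometry_mult[OF assms] by (simp_all add: polar_domain_def polar_part_def)

text \<open>For \<open>r\<close> in \<open>(0, 1]\<close>, replacing \<open>a\<close> by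
  \<open>r a\<close> turns \<open>p - adj a * a\<close> into a convex combination of itself and
  \<open>p\<close>, with positive weight on itself; this makes the bound strict.\<close>

lemma path_component_polar_domain_scaleR:
  assumes p: "projection p" and a: "a \<in> polar_domain p" and c: "0 < c" "c \<le> 1"
  shows "path_component (polar_domain p) a (c *\<^sub>R a)"
proof (rule path_component_linepath, rule subsetI)
  fix x assume "x \<in> closed_segment a (c *\<^sub>R a)"
  then obtain t where t: "0 \<le> t" "t \<le> 1" "x = (1 - t) *\<^sub>R a + t *\<^sub>R c *\<^sub>R a"
    by (auto simp: closed_segment_def)
  define r where "r = 1 - t + t * c"
  have x: "x = r *\<^sub>R a" by (simp add: t r_def scaleR_left_distrib)
  have "0 < r" using t(1,2) c by (cases "t = 1") (auto simp: r_def add_pos_nonneg)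
  moreover have "r \<le> 1" using t(1,2) c mult_left_mono[of c 1 t] by (simp add: r_def)
  ultimately have r: "0 < r\<^sup>2" "r\<^sup>2 \<le> 1" by (auto simp: power_le_one)
  have "p - adj x * x = (1 - r\<^sup>2) *\<^sub>R p + r\<^sup>2 *\<^sub>R (p - adj a * a)"
    by (simp add: x adj_scaleR algebra_simps power2_eq_square)
  also have "norm \<dots> \<le> norm ((1 - r\<^sup>2) *\<^sub>R p) + norm (r\<^sup>2 *\<^sub>R (p - adj a * a))"
    by (rule norm_triangle_ineq)
  also have "\<dots> = (1 - r\<^sup>2) * norm p + r\<^sup>2 * norm (p - adj a * a)" using r by simp
  also have "\<dots> < (1 - r\<^sup>2) * 1 + r\<^sup>2 * 1"
    using a r by (intro add_le_less_mono mult_left_mono mult_strict_left_mono norm_projection_le[OF p])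
      (auto simp: polar_domain_def)
  finally show "x \<in> polar_domain p" using a by (simp add: polar_domain_def x)
qed

text \<open>
  For small \<open>norm z\<close> this would be immediate. In general one moves along \<open>t\<close> in small steps;
  \<open>positive_invertible_norm_bound\<close> keeps the estimate from deteriorating.
\<close>

lemma segment_from_unit_positive_bound:
  fixes z :: "'a::cstar_algebra"
  assumes p: "projection p" and z: "z \<in> corner p" "norm z < 1"
  obtains K where "K \<ge> 1"
    "\<And>t. 0 \<le> t \<Longrightarrow> t \<le> 1 \<Longrightarrow> norm (K *\<^sub>R p - adj (p - t *\<^sub>R z) * (p - t *\<^sub>R z)) < K"
proof -
  define y where "y = (\<lambda>t. p - t *\<^sub>R z)"
  define m where "m = (\<lambda>t. adj (y t) * y t)"
  \<comment> \<open>\<open>\<beta>\<close> bounds the norm of the inverse of \<open>y t\<close>, as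
    for a Neumann series. \<open>M\<close> exceeds both 4, a bound for \<open>norm (m t)\<close>,
    and \<open>\<beta>\<^sup>2\<close>, a bound for the norm of the inverse of
    \<open>m t\<close>.\<close>
  define \<beta> where "\<beta> = 1 / (1 - norm z)"
  define M where "M = 5 + \<beta>\<^sup>2"
  define K where "K = M + 1 / M"
  have M: "M \<ge> 5" by (simp add: M_def)
  have \<beta>: "\<beta> > 0" using z(2) by (simp add: \<beta>_def)
  have y: "y t \<in> corner p" for t unfolding y_def by (intro corner_diff corner_scaleR corner_self p z)
  have m: "m t \<in> corner p" "adj (m t) = m t" for t
    unfolding m_def by (auto simp: adj_mult adj_adj intro!: corner_mult corner_adj p y)
  have y2: "norm (y t) \<le> 2" if "0 \<le> t" "t \<le> 1" for t
  proof -
    have "norm (y t) \<le> norm p + t * norm z"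
      using norm_triangle_ineq4[of p "t *\<^sub>R z"] that by (simp add: y_def)
    also have "\<dots> \<le> 1 + 1 * 1" using that z(2) by (intro add_mono mult_mono norm_projection_le[OF p]) auto
    finally show ?thesis by simp
  qed
  have m4: "norm (m t) < M" if "0 \<le> t" "t \<le> 1" for t
  proof -
    have "norm (m t) = (norm (y t))\<^sup>2" by (simp add: m_def norm_adj_mult_self)
    also have "\<dots> \<le> 2\<^sup>2" using y2[OF that] by (intro power_mono) auto
    finally show ?thesis using M by simp
  qed
  have lip: "norm (m t - m s) \<le> 4 * \<bar>t - s\<bar>" if "0 \<le> t" "t \<le> 1" "0 \<le> s" "s \<le> 1" for s t
  proof -
    have yd: "norm (y t - y s) \<le> \<bar>t - s\<bar>"
    proof -
      have "y t - y s = (s - t) *\<^sub>R z" by (simp add: y_def algebra_simps)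
      then have "norm (y t - y s) = \<bar>s - t\<bar> * norm z" by simp
      also have "\<dots> \<le> \<bar>s - t\<bar> * 1" using z(2) by (intro mult_left_mono) auto
      finally show ?thesis by simp
    qed
    have "m t - m s = adj (y t) * (y t - y s) + adj (y t - y s) * y s"
      by (simp add: m_def adj_diff algebra_simps)
    also have "norm \<dots> \<le> norm (adj (y t)) * norm (y t - y s) + norm (adj (y t - y s)) * norm (y s)"
      by (intro norm_triangle_le add_mono norm_mult_ineq)
    also have "\<dots> \<le> 2 * \<bar>t - s\<bar> + \<bar>t - s\<bar> * 2"
      unfolding norm_adj by (intro add_mono mult_mono y2 yd that) auto
    finally show ?thesis by simp
  qed
  have inv: "\<exists>n. n \<in> corner p \<and> n * m t = p \<and> norm n < M" if t: "0 \<le> t" "t \<le> 1" for t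
  proof -
    \<comment> \<open>The inverse of \<open>y t\<close> in the corner; \<open>i * adj i\<close> will
      be the inverse of \<open>m t\<close>.\<close>
    define i where "i = isqrt p (t *\<^sub>R z) * isqrt p (t *\<^sub>R z)"
    have tz: "norm (t *\<^sub>R z) \<le> norm z" "t *\<^sub>R z \<in> corner p"
      using t z by (auto simp: mult_left_le_one_le intro: corner_scaleR)
    have tz1: "norm (t *\<^sub>R z) < 1" using tz(1) z(2) by linarith
    have i: "i \<in> corner p" "i * y t = p"
      unfolding i_def y_def using isqrt_square[OF p tz(2) tz1] isqrt_corner[OF p tz(2) tz1]
      by (auto intro: corner_mult)
    have "(t *\<^sub>R z) * isqrt p (t *\<^sub>R z) = isqrt p (t *\<^sub>R z) * (t *\<^sub>R z)"
      using tz tz1 by (intro isqrt_intertwine) (auto simp: corner_def)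
    then have "(t *\<^sub>R z) * i = i * (t *\<^sub>R z)" unfolding i_def by (metis mult.assoc)
    then have "y t * i = i * y t"
      using i(1) by (simp only: y_def left_diff_distrib right_diff_distrib cornerD)
    then have yi: "y t * i = p" using i(2) by simp
    have "i = p + i * (t *\<^sub>R z)"
      using i by (simp add: y_def right_diff_distrib corner_def diff_eq_eq)
    then have "norm i \<le> norm p + norm (i * (t *\<^sub>R z))" by (metis norm_triangle_ineq)
    also have "\<dots> \<le> 1 + norm i * norm z"
      by (intro add_mono norm_projection_le[OF p] order_trans[OF norm_mult_ineq] mult_left_mono tz) auto
    finally have "norm i \<le> \<beta>" using z(2) by (simp add: \<beta>_def field_simps)
    have "i * adj i * m t = i * (adj (y t * i)) * y t" by (simp add: m_def adj_mult mult.assoc)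
    also have "\<dots> = p" using p i by (simp add: yi projection_def corner_def)
    finally have "i * adj i * m t = p" .
    moreover have "norm (i * adj i) < M"
    proof -
      have "norm (i * adj i) \<le> norm i * norm i" using norm_mult_ineq[of i "adj i"] by simp
      also have "\<dots> \<le> \<beta> * \<beta>" using \<open>norm i \<le> \<beta>\<close> \<beta> by (intro mult_mono) auto
      finally show ?thesis by (simp add: M_def power2_eq_square)
    qed
    moreover have "i * adj i \<in> corner p" by (intro corner_mult corner_adj p i)
    ultimately show ?thesis by blast
  qed
  \<comment> \<open>Any \<open>T\<close>, however large, yields the same bound \<open>M\<close>,
    which leaves a gap \<open>K - M = 1 / M\<close>.\<close>
  have boot: "norm (K *\<^sub>R p - m t) \<le> M" if "0 \<le> t" "t \<le> 1" "norm (T *\<^sub>R p - m t) < T" for t T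
    using positive_invertible_norm_bound[OF p m m4] inv that unfolding K_def by blast
  \<comment> \<open>A step of length \<open>1 / N\<close> moves \<open>m\<close> by at most
    \<open>4 / N\<close>, less than the gap. So the hypothesis of \<open>boot\<close> holds with
    \<open>T = K\<close> after the step, and \<open>boot\<close> restores the bound
    \<open>M\<close>.\<close>
  obtain N :: nat where N: "4 * M < real N" using reals_Archimedean2 by blast
  then have N0: "real N > 0" using M by linarith
  have step: "4 / real N < 1 / M" using N M N0 by (simp add: field_simps)
  have "\<forall>t. 0 \<le> t \<and> t \<le> 1 \<and> t \<le> real k / real N \<longrightarrow> norm (K *\<^sub>R p - m t) \<le> M" for k :: nat
  proof (induction k)
    case 0
    have "m 0 = p" using p by (simp add: m_def y_def projection_def)
    then have "norm (K *\<^sub>R p - m 0) \<le> M" by (intro boot[of 0 1]) auto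
    then show ?case by auto
  next
    case (Suc k)
    show ?case
    proof (intro allI impI, elim conjE)
      fix t :: real assume t: "0 \<le> t" "t \<le> 1" "t \<le> real (Suc k) / real N"
      define s where "s = max 0 (t - 1 / real N)"
      have s: "0 \<le> s" "s \<le> 1" "s \<le> real k / real N" "\<bar>t - s\<bar> \<le> 1 / real N"
      proof -
        have "0 < 1 / real N" using N0 by simp
        then show "0 \<le> s" "s \<le> 1" "\<bar>t - s\<bar> \<le> 1 / real N"
          using t(1,2) unfolding s_def by linarith+
        show "s \<le> real k / real N" using t(3) by (simp add: s_def add_divide_distrib)
      qed
      have "norm (K *\<^sub>R p - m t) \<le> norm (K *\<^sub>R p - m s) + norm (m t - m s)"
        using norm_triangle_ineq4[of "K *\<^sub>R p - m s" "m t - m s"] by simp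
      also have "\<dots> \<le> M + 4 * (1 / real N)"
        using Suc s(1-3) order_trans[OF lip[OF t(1,2) s(1,2)] mult_left_mono[OF s(4)]]
        by (intro add_mono) simp_all
      also have "\<dots> < K" using step by (simp add: K_def)
      finally show "norm (K *\<^sub>R p - m t) \<le> M" by (intro boot[of t K] t)
    qed
  qed
  from this[of N] have "norm (K *\<^sub>R p - m t) \<le> M" if "0 \<le> t" "t \<le> 1" for t
    using that N0 by simp
  moreover have "M < K" using M by (simp add: K_def)
  ultimately have "norm (K *\<^sub>R p - m t) < K" if "0 \<le> t" "t \<le> 1" for t
    using that le_less_trans by blast
  moreover have "K \<ge> 1" using M by (simp add: K_def add_increasing2)
  ultimately show ?thesis using that unfolding m_def y_def by blast
qed

section \<open>The homotopy\<close>

lemma norm_unit_minus_scaled_less_one: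
  fixes p :: "'a::cstar_algebra"
  assumes "norm (K *\<^sub>R p - m) < K"
  shows "norm (p - (1 / K) *\<^sub>R m) < 1"
proof -
  have K: "K > 0" using assms norm_ge_zero le_less_trans by blast
  then have "p - (1 / K) *\<^sub>R m = (1 / K) *\<^sub>R (K *\<^sub>R p - m)" by (simp add: scaleR_diff_right)
  then show ?thesis using assms K by simp
qed

text \<open>The path runs through small multiples of \<open>u\<close>, \<open>(u u*) v p\<close> and \<open>v p\<close>.\<close>

lemma path_component_compression:
  fixes u v :: "'a::cstar_algebra"
  assumes u: "partial_isometry u" and v: "partial_isometry v" and uv: "norm (u - v) < 1"
  defines "p \<equiv> adj u * u"
  shows "path_component (polar_domain p) u (v * p)"
proof -
  define u' where "u' = adj u"
  define v' where "v' = adj v"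
  have adjs: "adj u = u'" "adj v = v'" "adj u' = u" "adj v' = v" by (simp_all add: u'_def v'_def adj_adj)
  have p: "projection p" using u by (simp add: p_def partial_isometry_def)
  have p_eq: "p = u' * u" by (simp add: p_def u'_def)
  have r1: "u * (u' * u) = u" "v * (v' * v) = v" "u' * (u * u') = u'" "v' * (v * v') = v'"
    using partial_isometry_mult u v partial_isometry_adj
    unfolding u'_def v'_def by (metis adj_adj)+
  have r2: "u * (u' * (u * x)) = u * x" "v * (v' * (v * x)) = v * x"
    "u' * (u * (u' * x)) = u' * x" "v' * (v * (v' * x)) = v' * x" for x
    using r1 by (metis mult.assoc)+
  have nu: "norm u' \<le> 1" using norm_partial_isometry_le[OF u] by (simp add: u'_def)
  have q: "projection (v' * v)" using v by (simp add: v'_def partial_isometry_def)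
  note [simp] = adjs r1 r2 adj_mult adj_diff adj_scaleR adj_add
  \<comment> \<open>Chosen so that \<open>p - z = u' * (v * p)\<close>, the end of the first
    segment.\<close>
  define z where "z = u' * ((u - v) * p)"
  have z: "z \<in> corner p" by (simp add: corner_def z_def p_eq algebra_simps)
  have "norm z \<le> norm u' * (norm (u - v) * norm p)"
    unfolding z_def by (intro order_trans[OF norm_mult_ineq] mult_left_mono norm_mult_ineq) auto
  also have "\<dots> \<le> 1 * (norm (u - v) * 1)"
    by (intro mult_mono mult_left_mono nu norm_projection_le[OF p]) auto
  finally have z1: "norm z < 1" using uv by simp
  obtain K where K: "K \<ge> 1"
    "\<And>t. 0 \<le> t \<Longrightarrow> t \<le> 1 \<Longrightarrow> norm (K *\<^sub>R p - adj (p - t *\<^sub>R z) * (p - t *\<^sub>R z)) < K"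
    using segment_from_unit_positive_bound[OF p z z1] by blast
  \<comment> \<open>Scaling by \<open>c\<close> divides \<open>adj a * a\<close> by
    \<open>K\<close>, which turns a bound by \<open>K\<close> into the condition of
    \<open>polar_domain\<close>.\<close>
  define c where "c = 1 / sqrt K"
  have c: "0 < c" "c \<le> 1" "c * c = 1 / K"
    using K(1) by (auto simp: c_def)
  have scaled: "c *\<^sub>R a \<in> polar_domain p" if "a * p = a" "norm (K *\<^sub>R p - adj a * a) < K" for a
    using norm_unit_minus_scaled_less_one[OF that(2)] that(1) c(3) by (simp add: polar_domain_def)

  define y1 where "y1 = p - z"
  have uy1: "u * y1 = u * (u' * (v * p))" by (simp add: y1_def z_def p_eq algebra_simps)
  have y1: "adj y1 * y1 = p * (v' * (u * (u' * (v * p))))"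
    by (simp add: y1_def z_def p_eq algebra_simps)
  have K1: "norm (K *\<^sub>R p - adj y1 * y1) < K" using K(2)[of 1] by (simp add: y1_def)

  have "norm (p - p * (v' * v)) \<le> 1 * norm (u - v)"
  proof -
    \<comment> \<open>The terms in \<open>v\<close> cancel because
      \<open>v * (v' * v) = v\<close>.\<close>
    have "p - p * (v' * v) = u' * ((u - v) - (u - v) * (v' * v))"
      by (simp add: p_eq algebra_simps)
    also have "norm \<dots> \<le> norm u' * norm ((u - v) - (u - v) * (v' * v))" by (rule norm_mult_ineq)
    also have "\<dots> \<le> 1 * norm (u - v)"
      by (intro mult_mono nu norm_diff_mult_projection_le q) auto
    finally show ?thesis .
  qed
  then have lt: "norm (p - v' * (v * p)) < 1"
    using uv norm_adj[of "p - p * (v' * v)"] by (simp add: p_eq mult.assoc)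
  \<comment> \<open>Formally the element is \<open>(1 - v' * v) p\<close>, and
    \<open>1 - v' * v\<close> is a projection.\<close>
  have "adj (p - v' * (v * p)) * (p - v' * (v * p)) = p - adj (v * p) * (v * p)"
    by (simp add: p_eq algebra_simps)
  then have "norm (p - adj (v * p) * (v * p)) = (norm (p - v' * (v * p)))\<^sup>2"
    by (metis norm_adj_mult_self)
  then have vp1: "norm (p - adj (v * p) * (v * p)) < 1"
    using lt by (simp add: abs_square_less_1)
  have vp: "v * p \<in> polar_domain p" using vp1 by (simp add: polar_domain_def p_eq mult.assoc)
  have KV: "norm (K *\<^sub>R p - adj (v * p) * (v * p)) < K"
  proof -
    have "K *\<^sub>R p - adj (v * p) * (v * p) = (K - 1) *\<^sub>R p + (p - adj (v * p) * (v * p))"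
      by (simp add: scaleR_left_diff_distrib)
    also have "norm \<dots> \<le> (K - 1) * norm p + norm (p - adj (v * p) * (v * p))"
      using norm_triangle_ineq[of "(K - 1) *\<^sub>R p"] K(1) by (metis abs_of_nonneg diff_ge_0_iff_ge norm_scaleR)
    also have "\<dots> < (K - 1) * 1 + 1"
      using K(1) norm_projection_le[OF p] by (intro add_le_less_mono mult_left_mono vp1) auto
    finally show ?thesis by simp
  qed

  have "path_component (polar_domain p) u (c *\<^sub>R u)"
    using polar_domain_partial_isometry[OF u] c by (intro path_component_polar_domain_scaleR p) (auto simp: p_def)
  moreover have "path_component (polar_domain p) (c *\<^sub>R u) (c *\<^sub>R (u * y1))"
  proof (rule path_component_linepath, rule subsetI)
    fix x assume "x \<in> closed_segment (c *\<^sub>R u) (c *\<^sub>R (u * y1))"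
    then obtain t where t: "0 \<le> t" "t \<le> 1" "x = (1 - t) *\<^sub>R c *\<^sub>R u + t *\<^sub>R c *\<^sub>R (u * y1)"
      by (auto simp: closed_segment_def)
    let ?y = "p - t *\<^sub>R z"
    have x: "x = c *\<^sub>R (u * ?y)" by (simp add: t y1_def p_eq algebra_simps)
    have "p * ?y = ?y" using z p by (simp add: corner_def projection_def right_diff_distrib)
    then have "adj (u * ?y) * (u * ?y) = adj ?y * ?y" by (simp add: p_eq mult.assoc)
    moreover have "?y * p = ?y" using z p by (simp add: corner_def projection_def left_diff_distrib)
    ultimately show "x \<in> polar_domain p"
      unfolding x using K(2)[OF t(1,2)] by (intro scaled) (simp_all only: mult.assoc)
  qed
  moreover have "path_component (polar_domain p) (c *\<^sub>R (u * y1)) (c *\<^sub>R (v * p))"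
  proof (rule path_component_linepath, rule subsetI)
    fix x assume "x \<in> closed_segment (c *\<^sub>R (u * y1)) (c *\<^sub>R (v * p))"
    then obtain t where t: "0 \<le> t" "t \<le> 1" "x = (1 - t) *\<^sub>R c *\<^sub>R (u * y1) + t *\<^sub>R c *\<^sub>R (v * p)"
      by (auto simp: closed_segment_def)
    let ?a = "u * y1 + t *\<^sub>R (v * p - u * y1)"
    have x: "x = c *\<^sub>R ?a" by (simp add: t algebra_simps)
    have t2: "0 \<le> t\<^sup>2" "t\<^sup>2 \<le> 1" using t by (auto simp: power_le_one)
    \<comment> \<open>\<open>u * y1\<close> lies in the range of \<open>u u*\<close> and
      \<open>v * p - u * y1\<close> in its complement, so the cross terms vanish and only the square
      of \<open>t\<close> occurs.\<close>
    have "K *\<^sub>R p - adj ?a * ?a =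
        (1 - t\<^sup>2) *\<^sub>R (K *\<^sub>R p - adj y1 * y1) + t\<^sup>2 *\<^sub>R (K *\<^sub>R p - adj (v * p) * (v * p))"
      unfolding uy1 y1 by (simp add: p_eq algebra_simps power2_eq_square)
    also have "\<dots> \<in> ball 0 K"
      using K1 KV t2 by (intro convexD convex_ball) auto
    finally have "norm (K *\<^sub>R p - adj ?a * ?a) < K" by simp
    moreover have "?a * p = ?a" unfolding uy1 by (simp add: p_eq algebra_simps)
    ultimately show "x \<in> polar_domain p" unfolding x by (intro scaled)
  qed
  moreover have "path_component (polar_domain p) (c *\<^sub>R (v * p)) (v * p)"
    by (intro path_component_sym[OF path_component_polar_domain_scaleR] p vp c)
  ultimately show ?thesis by (meson path_component_trans)
qed

text \<open>With \<open>e = (1 - p) v*\<close>, the point \<open>x\<close> at parameter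
  \<open>t\<close> of the segment has \<open>q - adj x * x = (2t - t^2) adj e * e\<close>. Since
  \<open>u (1 - p) = 0\<close>, \<open>adj e = (v - u)(1 - p)\<close> has norm below 1.\<close>

lemma path_component_adj_compression:
  fixes u v :: "'a::cstar_algebra"
  assumes u: "partial_isometry u" and v: "partial_isometry v" and uv: "norm (u - v) < 1"
  defines "p \<equiv> adj u * u" and "q \<equiv> v * adj v"
  shows "path_component (polar_domain q) (adj v) (p * adj v)"
proof (rule path_component_linepath, rule subsetI)
  have p: "projection p" using u by (simp add: p_def partial_isometry_def)
  have vv: "adj v * (v * adj v) = adj v" "v * (adj v * v) = v"
    using partial_isometry_mult[OF v] partial_isometry_mult[OF partial_isometry_adj[OF v]]
    by (simp_all add: adj_adj)
  have up: "u * p = u" using partial_isometry_mult[OF u] by (simp add: p_def)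
  have pp: "adj p = p" "p * p = p" "p * (p * x) = p * x" for x
    using p by (auto simp: projection_def simp flip: mult.assoc)
  define e where "e = adj v - p * adj v"
  have "adj e = (v - u) - (v - u) * p" by (simp add: e_def adj_diff adj_mult adj_adj pp up algebra_simps)
  then have "norm e \<le> norm (v - u)"
    using norm_diff_mult_projection_le[OF p, of "v - u"] by (metis norm_adj)
  then have "norm e < 1" using uv by (simp add: norm_minus_commute)
  then have "(norm e)\<^sup>2 < 1" by (simp add: abs_square_less_1)
  then have ee: "norm (adj e * e) < 1" by (simp add: norm_adj_mult_self)
  fix x assume "x \<in> closed_segment (adj v) (p * adj v)"
  then obtain t where t: "0 \<le> t" "t \<le> 1" "x = (1 - t) *\<^sub>R adj v + t *\<^sub>R (p * adj v)"
    by (auto simp: closed_segment_def)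
  have x: "x = adj v - t *\<^sub>R e" by (simp add: t e_def algebra_simps)
  \<comment> \<open>All these products equal \<open>v (1 - p) v*\<close>.\<close>
  have "v * e = adj e * e" "adj e * adj v = adj e * e"
    by (simp_all add: e_def adj_diff adj_mult adj_adj pp algebra_simps)
  then have "q - adj x * x = (t + t - t * t) *\<^sub>R (adj e * e)"
    by (simp add: x q_def adj_diff adj_scaleR adj_adj algebra_simps)
      (simp flip: scaleR_left_distrib)
  also have "norm \<dots> = \<bar>t + t - t * t\<bar> * norm (adj e * e)" by simp
  also have "\<dots> \<le> 1 * norm (adj e * e)"
  proof (intro mult_right_mono)
    have "0 \<le> t * (2 - t)" "0 \<le> (1 - t) * (1 - t)" using t by auto
    then show "\<bar>t + t - t * t\<bar> \<le> 1" by (simp add: algebra_simps)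
  qed simp
  finally have "norm (q - adj x * x) < 1" using ee by simp
  moreover have "x * q = x" by (simp add: x q_def e_def algebra_simps vv)
  ultimately show "x \<in> polar_domain q" by (simp add: polar_domain_def)
qed

lemma path_component_partial_isometry:
  fixes u v :: "'a::cstar_algebra"
  assumes u: "partial_isometry u" and v: "partial_isometry v" and uv: "norm (u - v) < 1"
  shows "path_component (Collect partial_isometry) u v"
proof -
  define p where "p = adj u * u"
  define q where "q = v * adj v"
  have pq: "projection p" "projection q"
    using u partial_isometry_adj[OF v] by (simp_all add: p_def q_def partial_isometry_def adj_adj)
  have up: "path_component (Collect partial_isometry) u (polar_part p (v * p))"
    using path_component_polar_part[OF pq(1) path_component_compression[OF u v uv, folded p_def]]
      polar_domain_partial_isometry(2)[OF u] by (simp add: p_def)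
  have "path_component (Collect partial_isometry) (adj v) (polar_part q (p * adj v))"
    using path_component_polar_part[OF pq(2) path_component_adj_compression[OF u v uv, folded p_def q_def]]
      polar_domain_partial_isometry(2)[OF partial_isometry_adj[OF v]] by (simp add: q_def adj_adj)
  moreover have "continuous_on (Collect partial_isometry) (adj :: 'a \<Rightarrow> 'a)"
    by (intro continuous_intros)
  moreover have "adj ` Collect partial_isometry \<subseteq> (Collect partial_isometry :: 'a set)"
    using partial_isometry_adj by auto
  ultimately have down: "path_component (Collect partial_isometry) v (adj (polar_part q (p * adj v)))"
    using path_component_continuous_image by (metis adj_adj)
  have D: "v * p \<in> polar_domain p" "p * adj v \<in> polar_domain q"
    using path_component_compression[OF u v uv] path_component_adj_compression[OF u v uv]
    unfolding p_def q_def by (auto dest: path_component_mem)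
  have pp: "adj p = p" "p * p = p" "p * (p * x) = p * x" for x
    using pq(1) by (auto simp: projection_def simp flip: mult.assoc)
  have vv: "v * (adj v * v) = v" "v * (adj v * (v * x)) = v * x" for x
    using partial_isometry_mult[OF v] by (auto simp flip: mult.assoc)
  define z where "z = p - adj (v * p) * (v * p)"
  define z' where "z' = q - adj (p * adj v) * (p * adj v)"
  have "adj (p * adj v) * (p * adj v) \<in> corner q"
    using D(2) by (intro adj_mult_self_corner pq) (simp add: polar_domain_def)
  then have z': "z' \<in> corner q" "adj z' = z'" "norm z' < 1" "norm z < 1"
    using D pq(2) unfolding z_def z'_def
    by (simp_all add: corner_diff corner_self polar_domain_def adj_diff adj_mult adj_adj)
      (simp add: projection_def)
  \<comment> \<open>Both \<open>v * p * z\<close> and \<open>z' * (v * p)\<close> equal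
    \<open>v * p - v * p * adj v * v * p\<close>, so \<open>v * p\<close> intertwines the inverse
    square roots in the two corners.\<close>
  have "v * p * isqrt p z = isqrt q z' * (v * p)"
    by (rule isqrt_intertwine)
      (use z' in \<open>auto simp: z_def z'_def q_def adj_mult adj_adj pp vv algebra_simps\<close>)
  moreover have "adj (isqrt q z') = isqrt q z'" using isqrt_adj pq(2) z' by blast
  ultimately have "polar_part p (v * p) = adj (polar_part q (p * adj v))"
    unfolding polar_part_def z_def[symmetric] z'_def[symmetric]
    by (simp add: adj_mult adj_adj pp)
  with up down show ?thesis by (metis path_component_sym path_component_trans)
qed

theorem theorem4:
  fixes u v :: "'a::cstar_algebra"
  assumes "partial_isometry u"
    and "partial_isometry v"
    and "norm (u - v) < 1"
  shows "\<exists>w :: real \<Rightarrow> 'a. continuous_on {0..1} w \<and>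
    (\<forall>t\<in>{0..1}. partial_isometry (w t)) \<and> w 0 = u \<and> w 1 = v"
proof -
  obtain g where g: "path g" "path_image g \<subseteq> Collect partial_isometry" "pathstart g = u" "pathfinish g = v"
    using path_component_partial_isometry[OF assms] unfolding path_component_def by blast
  show ?thesis
  proof (intro exI conjI)
    show "continuous_on {0..1} g" using g(1) by (simp add: path_def)
    show "\<forall>t\<in>{0..1}. partial_isometry (g t)" using g(2) by (auto simp: path_image_def)
    show "g 0 = u" "g 1 = v" using g(3,4) by (simp_all add: pathstart_def pathfinish_def)
  qed
qed

end
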